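(* Let $N \ge 1$ be an integer, let $A \in \mathbb{R}^{n\times n}$, $B \in \mathbb{R}^{n \times 1}$, $C \in \mathbb{R}^{1\times n}$, $D \in \mathbb{R}$ with spectral radius $\rho(A)<1$, and let $P(z) = D + C(zI-A)^{-1}B$. Let $F, G, H, J$ be the lifted matrices over a batch of length $N$, and let $\mathcal{F}$ be the $N\times N$ DFT matrix (both defined in the context). Then $$\mathcal{F}^{*}\bigl(H(I-F)^{-1}G+J\bigr)\mathcal{F} = \mathrm{diag}\bigl(P(e^{-j\omega_0}), P(e^{-j\omega_1}),\ldots,P(e^{-j\omega_{N-1}})\bigr), \qquad \omega_m = \frac{2\pi m}{N},\ m=0,1,\ldots,N-1.$$
   Context: Here $j$ denotes the imaginary unit and $^*$ the conjugate transpose. The system is the discrete-time single-input single-output linear time-invariant system $x(k+1)=Ax(k)+Bu(k)$, $y(k)=Cx(k)+Du(k)$, with transfer function $P(z)=D+C(zI-A)^{-1}B$. The lifted matrices, which describe the system processed in batches of $N$ samples, are $$F = A^N \in \mathbb{R}^{n\times n}, \qquad G = \begin{bmatrix} A^{N-1}B & A^{N-2}B & \cdots & AB & B\end{bmatrix} \in \mathbb{R}^{n\times N},$$ $$H = \begin{bmatrix} C \\ CA \\ \vdots \\ CA^{N-1}\end{bmatrix} \in \mathbb{R}^{N\times n},$$ and $J \in \mathbb{R}^{N\times N}$ is the lower-triangular Toeplitz matrix with entries $J_{p,p}=D$, $J_{p,q}=CA^{p-q-1}B$ for $p>q$, and $J_{p,q}=0$ for $p<q$ ($1\le p,q\le N$).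 The DFT matrix $\mathcal{F}\in\mathbb{C}^{N\times N}$ has $(p,q)$ entry $\frac{1}{\sqrt N}W_N^{(p-1)(q-1)}$, $1\le p,q\le N$, where $W_N = e^{-2\pi j/N}$. *)

theory Defs
  imports
    Complex_Main
    "Jordan_Normal_Form.Gauss_Jordan_Elimination"
    "Jordan_Normal_Form.Schur_Decomposition"
    "Jordan_Normal_Form.Spectral_Radius"
begin

(* Unspecified on singular or non-square matrices. *)
abbreviation mat_inv :: "'a :: field mat \<Rightarrow> 'a mat" where
  "mat_inv M \<equiv> the (mat_inverse M)"

abbreviation complex_mat :: "real mat \<Rightarrow> complex mat" where
  "complex_mat \<equiv> map_mat complex_of_real"

(* C (zI - A)^(-1) B is a 1 x 1 matrix; D is a scalar. *)
definition transfer_function ::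
  "real mat \<Rightarrow> real mat \<Rightarrow> real mat \<Rightarrow> real \<Rightarrow> complex \<Rightarrow> complex" where
  "transfer_function A B C D z =
     complex_of_real D +
     (complex_mat C * mat_inv (z \<cdot>\<^sub>m 1\<^sub>m (dim_row A) - complex_mat A) * complex_mat B) $$ (0, 0)"

(* Matrix indices start at 0, so p and q below are one less than in the usual 1-based formulas. *)

definition lifted_F :: "real mat \<Rightarrow> nat \<Rightarrow> real mat" where
  "lifted_F A N = A ^\<^sub>m N"

definition lifted_G :: "real mat \<Rightarrow> real mat \<Rightarrow> nat \<Rightarrow> real mat" where
  "lifted_G A B N = mat (dim_row A) N (\<lambda>(i, q). (A ^\<^sub>m (N - 1 - q) * B) $$ (i, 0))"

definition lifted_H :: "real mat \<Rightarrow> real mat \<Rightarrow> nat \<Rightarrow> real mat" where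
  "lifted_H A C N = mat N (dim_row A) (\<lambda>(p, i). (C * A ^\<^sub>m p) $$ (0, i))"

definition lifted_J :: "real mat \<Rightarrow> real mat \<Rightarrow> real mat \<Rightarrow> real \<Rightarrow> nat \<Rightarrow> real mat" where
  "lifted_J A B C D N = mat N N (\<lambda>(p, q).
     if p = q then D
     else if q < p then (C * A ^\<^sub>m (p - q - 1) * B) $$ (0, 0)
     else 0)"

definition dft_mat :: "nat \<Rightarrow> complex mat" where
  "dft_mat N = mat N N (\<lambda>(p, q).
     complex_of_real (1 / sqrt (real N)) * exp (- (2 * complex_of_real pi * \<i> / of_nat N)) ^ (p * q))"

definition dft_freq :: "nat \<Rightarrow> nat \<Rightarrow> real" where
  "dft_freq N m = 2 * pi * real m / real N"

end

theory Submission
  imports Defs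
begin

text \<open>
  The lifted matrix maps one period of an input to the corresponding period of the steady-state
  output. Fix an \<open>N\<close>-th root of unity \<open>z\<close> and put \<open>X = (z I - A)\<^sup>-\<^sup>1 B\<close>. The input \<open>u(k) = z ^ k\<close> is
  \<open>N\<close>-periodic, and the state sequence \<open>x(k) = z ^ k X\<close> solves \<open>x(k+1) = A x(k) + B u(k)\<close>, so that
  the output is \<open>P(z) z ^ k\<close>. Hence the vector \<open>v = (1, z, \<dots>, z ^ (N-1))\<close> should be an
  eigenvector of \<open>H (I - F)\<^sup>-\<^sup>1 G + J\<close> with eigenvalue \<open>P(z)\<close>. The columns of the DFT matrix are
  these vectors, normalised, for \<open>z\<close> running through all \<open>N\<close>-th roots of unity; as the DFT matrix
  is unitary (\<open>dft_mat_unitary\<close>), it diagonalises the lifted matrix.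

  The eigenvector property (\<open>lifted_system_maps_exponentials\<close>) comes from a single telescoping
  sum (\<open>geometric_input_response\<close>),
  \<open>(\<Sum>q<p. z ^ q A ^ (p-1-q) (z I - A) X) = z ^ p X - A ^ p X\<close>. With \<open>p = N\<close> it says
  \<open>G v = (I - F) X\<close>, so \<open>X\<close> is the state at the start of the batch and \<open>H X\<close> has the entries
  \<open>C A ^ p X\<close>; applied to row \<open>p\<close> of \<open>J v\<close> it yields \<open>D z ^ p + z ^ p C X - C A ^ p X\<close>. The
  terms with \<open>A ^ p\<close> cancel and \<open>z ^ p (D + C X) = z ^ p P(z)\<close> remains.

  The bound on the spectral radius makes \<open>z I - A\<close> invertible for all \<open>z\<close> on the unit circle
  (\<open>det_resolvent_nonzero\<close>). That \<open>I - A ^ N\<close> is invertible follows from the same telescoping sum,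
  weighted by \<open>z\<close> and averaged over all \<open>N\<close>-th roots of unity (\<open>det_one_minus_pow_nonzero\<close>).
\<close>

section \<open>Matrix products, inverses and resolvents\<close>

lemma index_mult_mat_sum:
  fixes M K :: "'a :: semiring_0 mat"
  assumes "M \<in> carrier_mat a b" "K \<in> carrier_mat b c" "i < a" "j < c"
  shows "(M * K) $$ (i, j) = (\<Sum>k<b. M $$ (i, k) * K $$ (k, j))"
  using assms by (auto simp: scalar_prod_def lessThan_atLeast0)

lemma mat_inv_properties:
  fixes M :: "'a :: field mat"
  assumes M: "M \<in> carrier_mat n n" and det: "det M \<noteq> 0"
  shows "mat_inv M \<in> carrier_mat n n" "M * mat_inv M = 1\<^sub>m n" "mat_inv M * M = 1\<^sub>m n"
proof -
  have "M \<in> Units (ring_mat TYPE('a) n ())"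
    by (rule det_non_zero_imp_unit[OF M det])
  with mat_inverse(1)[OF M, of "()"] obtain X where "mat_inverse M = Some X"
    by (cases "mat_inverse M") auto
  with mat_inverse(2)[OF M this]
  show "mat_inv M \<in> carrier_mat n n" "M * mat_inv M = 1\<^sub>m n" "mat_inv M * M = 1\<^sub>m n"
    by auto
qed

text \<open>A singular \<open>z I - A\<close> would make \<open>z\<close> an eigenvalue outside the disc that contains the spectrum.\<close>

lemma det_resolvent_nonzero:
  assumes A: "A \<in> carrier_mat n n" and rho: "spectral_radius A < 1" and z: "norm z \<ge> 1"
  shows "det (z \<cdot>\<^sub>m 1\<^sub>m n - A) \<noteq> 0"
proof
  assume "det (z \<cdot>\<^sub>m 1\<^sub>m n - A) = 0"
  moreover have "z \<cdot>\<^sub>m 1\<^sub>m n - A = - char_matrix A z"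
    using A by (intro eq_matI) (auto simp: char_matrix_def)
  ultimately have "det (char_matrix A z) = 0"
    using det_0_negate[OF char_matrix_closed[OF A]] by simp
  hence ev: "eigenvalue A z"
    using eigenvalue_det[OF A] by simp
  hence "norm z \<in> norm ` spectrum A"
    by (simp add: spectrum_def)
  from spectral_radius_mem_max(2)[OF A eigenvalue_imp_nonzero_dim[OF A ev] this] rho z
  show False by simp
qed

section \<open>Response to a geometric input\<close>

text \<open>
  Since \<open>A ^ r (z I - A) X = z A ^ r X - A ^ (r+1) X\<close>, consecutive terms cancel. The factor \<open>M\<close>
  lets the same identity serve for the state (\<open>M = I\<close>) and for the output (\<open>M = C\<close>), and
  \<open>X\<close> may have several columns so that it can also be a full resolvent.
\<close>

lemma geometric_input_response:
  fixes A X M :: "'a :: comm_ring_1 mat"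
  assumes A: "A \<in> carrier_mat n n" and X: "X \<in> carrier_mat n k" and M: "M \<in> carrier_mat m n"
    and i: "i < m" and j: "j < k"
  shows "(\<Sum>q<p. z ^ q * (M * A ^\<^sub>m (p - 1 - q) * ((z \<cdot>\<^sub>m 1\<^sub>m n - A) * X)) $$ (i, j))
    = z ^ p * (M * X) $$ (i, j) - (M * A ^\<^sub>m p * X) $$ (i, j)"
proof -
  define a where "a r = (M * A ^\<^sub>m r * X) $$ (i, j)" for r
  have step: "(M * A ^\<^sub>m r * ((z \<cdot>\<^sub>m 1\<^sub>m n - A) * X)) $$ (i, j) = z * a r - a (Suc r)" for r
  proof -
    define K where "K = M * A ^\<^sub>m r"
    have K: "K \<in> carrier_mat m n" using M A by (auto simp: K_def)
    have "(z \<cdot>\<^sub>m 1\<^sub>m n - A) * X = z \<cdot>\<^sub>m X - A * X"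
      using A X by (subst minus_mult_distrib_mat[of _ n n _ _ k])
        (auto simp: smult_carrier_mat mult_smult_assoc_mat[of _ n n _ k])
    hence "K * ((z \<cdot>\<^sub>m 1\<^sub>m n - A) * X) = z \<cdot>\<^sub>m (K * X) - K * (A * X)"
      using K A X by (simp add: mult_minus_distrib_mat[of _ m n _ k] mult_smult_distrib[of _ m n _ k])
    also have "K * (A * X) = M * A ^\<^sub>m Suc r * X"
      using K A X M by (simp add: K_def assoc_mult_mat[of _ m n _ n _ n]
        assoc_mult_mat[of _ m n _ n _ k, symmetric])
    finally show ?thesis using K A X M i j by (simp add: a_def K_def)
  qed
  have "(\<Sum>q<p. z ^ q * (M * A ^\<^sub>m (p - 1 - q) * ((z \<cdot>\<^sub>m 1\<^sub>m n - A) * X)) $$ (i, j))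
      = (\<Sum>q<p. z ^ Suc q * a (p - Suc q) - z ^ q * a (p - q))"
  proof (rule sum.cong[OF refl])
    fix q assume "q \<in> {..<p}"
    hence "Suc (p - 1 - q) = p - q" by simp
    thus "z ^ q * (M * A ^\<^sub>m (p - 1 - q) * ((z \<cdot>\<^sub>m 1\<^sub>m n - A) * X)) $$ (i, j)
      = z ^ Suc q * a (p - Suc q) - z ^ q * a (p - q)"
      by (simp add: step algebra_simps)
  qed
  also have "\<dots> = z ^ p * a 0 - a p"
    using sum_lessThan_telescope[of "\<lambda>q. z ^ q * a (p - q)" p] by simp
  finally show ?thesis using M A by (simp add: a_def)
qed

section \<open>Roots of unity\<close>

text \<open>The points at which the transfer function is sampled, that is, the powers of \<open>W\<^sub>N\<close>.\<close>

definition dft_node :: "nat \<Rightarrow> nat \<Rightarrow> complex" where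
  "dft_node N m = exp (- \<i> * complex_of_real (dft_freq N m))"

lemma dft_node_eq_cis: "dft_node N m = cis (- dft_freq N m)"
  by (simp add: dft_node_def cis_conv_exp mult_ac)

lemma norm_dft_node [simp]: "norm (dft_node N m) = 1"
  by (simp add: dft_node_eq_cis)

lemma dft_node_0 [simp]: "dft_node N 0 = 1"
  by (simp add: dft_node_def dft_freq_def)

lemma dft_node_eq_power: "dft_node N m = dft_node N 1 ^ m"
  by (simp add: dft_node_eq_cis DeMoivre dft_freq_def mult_ac)

text \<open>The symmetry of the DFT matrix, up to normalisation: both sides are \<open>W\<^sub>N ^ (p q)\<close>.\<close>

lemma dft_node_power_commute: "dft_node N p ^ q = dft_node N q ^ p"
  by (metis dft_node_eq_power power_mult mult.commute)

lemma dft_node_power_N: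
  assumes "N > 0"
  shows "dft_node N m ^ N = 1"
proof -
  have "real N * - dft_freq N m = 2 * pi * of_int (- int m)"
    using assms by (simp add: dft_freq_def)
  thus ?thesis
    unfolding dft_node_eq_cis DeMoivre by (simp only: cis_multiple_2pi Ints_of_int)
qed

lemma inj_on_dft_node:
  assumes "N > 0"
  shows "inj_on (dft_node N) {..<N}"
proof -
  have "inj_on (\<lambda>k. cnj (cis (2 * pi * real k / real N))) {..<N}"
    using bij_betw_imp_inj_on[OF bij_betw_roots_unity[OF assms]] by (auto simp: inj_on_def)
  thus ?thesis by (simp add: dft_node_eq_cis dft_freq_def cis_cnj inj_on_def)
qed

lemma sum_powers_of_nontrivial_root:
  fixes r :: "'a :: field"
  assumes "r ^ N = 1" "r \<noteq> 1"
  shows "(\<Sum>q<N. r ^ q) = 0"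
  using assms by (simp add: sum_gp_strict)

text \<open>By symmetry, the sum over all nodes is a geometric sum of powers of the node \<open>q\<close>, which is not 1.\<close>

lemma sum_dft_node_power:
  assumes "0 < q" "q < N"
  shows "(\<Sum>m<N. dft_node N m ^ q) = 0"
proof -
  have "dft_node N q \<noteq> dft_node N 0"
    using inj_onD[OF inj_on_dft_node[of N], of q 0] assms by auto
  with sum_powers_of_nontrivial_root[of "dft_node N q" N] dft_node_power_N[of N q] assms
  show ?thesis by (simp add: dft_node_power_commute[of N _ q])
qed

lemma dft_mat_entry:
  assumes "p < N" "m < N"
  shows "dft_mat N $$ (p, m) = dft_node N m ^ p / complex_of_real (sqrt (real N))"
proof -
  have "exp (- (2 * complex_of_real pi * \<i> / of_nat N)) = dft_node N 1"
    by (simp add: dft_node_def dft_freq_def mult_ac)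
  moreover have "dft_node N m ^ p = dft_node N 1 ^ (p * m)"
    by (metis dft_node_eq_power power_mult mult.commute)
  ultimately show ?thesis using assms by (simp add: dft_mat_def)
qed

lemma dft_mat_carrier [simp]: "dft_mat N \<in> carrier_mat N N"
  by (simp add: dft_mat_def)

lemma mat_adjoint_carrier:
  "M \<in> carrier_mat m n \<Longrightarrow> mat_adjoint M \<in> carrier_mat n m"
  by (auto simp: mat_adjoint_def)

lemma mat_adjoint_entry:
  fixes M :: "complex mat"
  assumes "M \<in> carrier_mat m n" "i < n" "j < m"
  shows "mat_adjoint M $$ (i, j) = cnj (M $$ (j, i))"
  using assms by (auto simp: mat_adjoint_def mat_of_rows_index)

text \<open>
  Entry \<open>(l, m)\<close> of the product is the average of the powers of the ratio of the nodes \<open>m\<close> and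
  \<open>l\<close>, a root of unity that is trivial only on the diagonal.
\<close>

lemma dft_mat_unitary:
  assumes N: "N > 0"
  shows "mat_adjoint (dft_mat N) * dft_mat N = 1\<^sub>m N"
proof (rule eq_matI)
  let ?s = "complex_of_real (sqrt (real N))"
  fix l m assume "l < dim_row (1\<^sub>m N :: complex mat)" "m < dim_col (1\<^sub>m N :: complex mat)"
  hence l: "l < N" and m: "m < N" by auto
  define r where "r = cnj (dft_node N l) * dft_node N m"
  have ss: "?s * ?s = of_nat N"
    by (simp flip: of_real_mult)
  have "(mat_adjoint (dft_mat N) * dft_mat N) $$ (l, m)
      = (\<Sum>q<N. cnj (dft_mat N $$ (q, l)) * dft_mat N $$ (q, m))"
    using l by (simp add: mat_adjoint_entry[OF dft_mat_carrier]
      index_mult_mat_sum[OF mat_adjoint_carrier[OF dft_mat_carrier] dft_mat_carrier l m])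
  also have "\<dots> = (\<Sum>q<N. r ^ q / of_nat N)"
    using l m ss by (intro sum.cong refl) (auto simp: dft_mat_entry r_def power_mult_distrib)
  also have "\<dots> = (\<Sum>q<N. r ^ q) / of_nat N"
    by (simp add: sum_divide_distrib)
  also have "\<dots> = (if l = m then 1 else 0)"
  proof (cases "l = m")
    case True
    hence "r = 1"
      using complex_norm_square[of "dft_node N m"] by (simp add: r_def mult.commute)
    thus ?thesis using True N by simp
  next
    case False
    have "dft_node N l * cnj (dft_node N l) = 1"
      using complex_norm_square[of "dft_node N l"] by simp
    hence "dft_node N m = dft_node N l * r" by (simp add: r_def mult.assoc[symmetric])
    moreover have "dft_node N m \<noteq> dft_node N l"
      using False inj_on_dft_node[OF N] l m by (auto simp: inj_on_def)
    ultimately have "r \<noteq> 1" by auto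
    moreover have "r ^ N = 1"
      using dft_node_power_N[OF N] by (simp add: r_def power_mult_distrib flip: complex_cnj_power)
    ultimately show ?thesis using False sum_powers_of_nontrivial_root[of r N] by simp
  qed
  finally show "(mat_adjoint (dft_mat N) * dft_mat N) $$ (l, m) = 1\<^sub>m N $$ (l, m)"
    using l m by simp
qed (use mat_adjoint_carrier[OF dft_mat_carrier, of N] in \<open>auto simp: dft_mat_def\<close>)

section \<open>Invertibility over one batch\<close>

text \<open>
  Write \<open>R\<^sub>m\<close> for the resolvent at the node \<open>z\<^sub>m\<close>. The telescoping sum with \<open>X = R\<^sub>m\<close> gives
  \<open>(I - A ^ N) R\<^sub>m = (\<Sum>q<N. z\<^sub>m ^ q A ^ (N-1-q))\<close>. After multiplication by \<open>z\<^sub>m\<close> and summation over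
  \<open>m\<close>, only the term with \<open>q = N - 1\<close> survives, because the sum of \<open>z\<^sub>m ^ (q+1)\<close> over \<open>m\<close> vanishes
  unless \<open>N\<close> divides \<open>q + 1\<close>. So \<open>I - A ^ N\<close> times \<open>Y = (\<Sum>m<N. z\<^sub>m R\<^sub>m)\<close> is \<open>N I\<close>, which is
  invertible.
\<close>

lemma det_one_minus_pow_nonzero:
  fixes A :: "complex mat"
  assumes A: "A \<in> carrier_mat n n" and N: "N > 0"
    and det: "\<And>m. m < N \<Longrightarrow> det (dft_node N m \<cdot>\<^sub>m 1\<^sub>m n - A) \<noteq> 0"
  shows "det (1\<^sub>m n - A ^\<^sub>m N) \<noteq> 0"
proof -
  let ?z = "dft_node N"
  define R where "R m = mat_inv (?z m \<cdot>\<^sub>m 1\<^sub>m n - A)" for m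
  define Y where "Y = mat n n (\<lambda>(i, j). \<Sum>m<N. ?z m * R m $$ (i, j))"
  have Y: "Y \<in> carrier_mat n n" by (simp add: Y_def)
  have zA: "?z m \<cdot>\<^sub>m 1\<^sub>m n - A \<in> carrier_mat n n" for m using A by auto
  have R: "R m \<in> carrier_mat n n" "(?z m \<cdot>\<^sub>m 1\<^sub>m n - A) * R m = 1\<^sub>m n" if "m < N" for m
    using mat_inv_properties[OF zA det[OF that]] by (auto simp: R_def)
  have AN: "A ^\<^sub>m r \<in> carrier_mat n n" for r using A by simp
  have F: "1\<^sub>m n - A ^\<^sub>m N \<in> carrier_mat n n" by (rule minus_carrier_mat[OF AN])
  have "(1\<^sub>m n - A ^\<^sub>m N) * Y = of_nat N \<cdot>\<^sub>m 1\<^sub>m n"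
  proof (rule eq_matI)
    fix i j assume "i < dim_row (of_nat N \<cdot>\<^sub>m 1\<^sub>m n :: complex mat)"
      "j < dim_col (of_nat N \<cdot>\<^sub>m 1\<^sub>m n :: complex mat)"
    hence i: "i < n" and j: "j < n" by auto
    have col: "(\<Sum>q<N. ?z m ^ q * (A ^\<^sub>m (N - 1 - q)) $$ (i, j))
      = ((1\<^sub>m n - A ^\<^sub>m N) * R m) $$ (i, j)" if m: "m < N" for m
    proof -
      have "((1\<^sub>m n - A ^\<^sub>m N) * R m) = R m - A ^\<^sub>m N * R m"
        using AN[of N] R(1)[OF m] by (simp add: minus_mult_distrib_mat[of _ n n _ _ n])
      thus ?thesis
        using geometric_input_response[OF A R(1)[OF m] one_carrier_mat i j, of "?z m" N]
          carrier_matD[OF R(1)[OF m]] carrier_matD[OF AN[of N]] i j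
        by (simp only: R(2)[OF m] right_mult_one_mat[OF AN] left_mult_one_mat[OF AN]
            left_mult_one_mat[OF R(1)[OF m]]
            dft_node_power_N[OF N]) simp
    qed
    have "((1\<^sub>m n - A ^\<^sub>m N) * Y) $$ (i, j)
        = (\<Sum>k<n. (1\<^sub>m n - A ^\<^sub>m N) $$ (i, k) * (\<Sum>m<N. ?z m * R m $$ (k, j)))"
      unfolding index_mult_mat_sum[OF F Y i j] using j by (simp add: Y_def)
    also have "\<dots> = (\<Sum>m<N. ?z m * (\<Sum>k<n. (1\<^sub>m n - A ^\<^sub>m N) $$ (i, k) * R m $$ (k, j)))"
      by (subst (2) sum_distrib_left, subst sum_distrib_left, subst sum.swap)
        (simp add: mult_ac)
    also have "\<dots> = (\<Sum>m<N. ?z m * ((1\<^sub>m n - A ^\<^sub>m N) * R m) $$ (i, j))"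
    proof (intro sum.cong refl)
      fix m assume "m \<in> {..<N}"
      hence "R m \<in> carrier_mat n n" using R by simp
      thus "?z m * (\<Sum>k<n. (1\<^sub>m n - A ^\<^sub>m N) $$ (i, k) * R m $$ (k, j))
        = ?z m * ((1\<^sub>m n - A ^\<^sub>m N) * R m) $$ (i, j)"
        using index_mult_mat_sum[OF F _ i j] by simp
    qed
    also have "\<dots> = (\<Sum>m<N. ?z m * (\<Sum>q<N. ?z m ^ q * (A ^\<^sub>m (N - 1 - q)) $$ (i, j)))"
      by (intro sum.cong refl) (simp only: col lessThan_iff)
    also have "\<dots> = (\<Sum>q<N. (\<Sum>m<N. ?z m ^ Suc q) * (A ^\<^sub>m (N - 1 - q)) $$ (i, j))"
      by (simp only: sum_distrib_left sum_distrib_right, subst sum.swap) (simp add: mult_ac)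
    also have "\<dots> = (\<Sum>q<N. if q = N - 1 then of_nat N * 1\<^sub>m n $$ (i, j) else 0)"
    proof (intro sum.cong refl)
      fix q assume q: "q \<in> {..<N}"
      show "(\<Sum>m<N. ?z m ^ Suc q) * (A ^\<^sub>m (N - 1 - q)) $$ (i, j)
        = (if q = N - 1 then of_nat N * 1\<^sub>m n $$ (i, j) else 0)"
      proof (cases "q = N - 1")
        case True
        hence "Suc q = N" using N by simp
        thus ?thesis using True A by (simp add: dft_node_power_N[OF N] del: power_Suc)
      next
        case False
        with q sum_dft_node_power[of "Suc q" N] show ?thesis by (simp del: power_Suc)
      qed
    qed
    also have "\<dots> = of_nat N * 1\<^sub>m n $$ (i, j)" using N by simp
    finally show "((1\<^sub>m n - A ^\<^sub>m N) * Y) $$ (i, j) = (of_nat N \<cdot>\<^sub>m 1\<^sub>m n) $$ (i, j)"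
      using i j by simp
  qed (use F Y in auto)
  hence "det (1\<^sub>m n - A ^\<^sub>m N) * det Y = of_nat N ^ n"
    using det_mult[OF F Y] by simp
  thus ?thesis using N by auto
qed

section \<open>The lifted system\<close>

lemma complex_mat_mult:
  assumes "M \<in> carrier_mat l m" "K \<in> carrier_mat m r"
  shows "complex_mat (M * K) = complex_mat M * complex_mat K"
  by (rule of_real_hom.mat_hom_mult[OF assms])

lemma complex_mat_entry:
  assumes "M \<in> carrier_mat a b" "i < a" "j < b"
  shows "complex_of_real (M $$ (i, j)) = complex_mat M $$ (i, j)"
  using assms by simp

lemma complex_mat_pow:
  "A \<in> carrier_mat n n \<Longrightarrow> complex_mat (A ^\<^sub>m k) = complex_mat A ^\<^sub>m k"
  by (rule of_real_hom.mat_hom_pow)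

lemma complex_mat_one_minus_lifted_F:
  assumes "A \<in> carrier_mat n n"
  shows "complex_mat (1\<^sub>m n - lifted_F A N) = 1\<^sub>m n - complex_mat A ^\<^sub>m N"
proof -
  have "complex_mat (1\<^sub>m n - M) = 1\<^sub>m n - complex_mat M" if "M \<in> carrier_mat n n" for M
    using that by (intro eq_matI) auto
  from this[OF pow_carrier_mat[OF assms]] show ?thesis
    by (simp add: lifted_F_def complex_mat_pow[OF assms])
qed

text \<open>
  Row \<open>p\<close> of the eigenvector equation for the exponential \<open>(z ^ q)\<close>. The matrix \<open>X\<close> below is the
  initial state of the periodic trajectory driven by this input.
\<close>

lemma lifted_system_maps_exponentials:
  fixes A B C :: "real mat" and D :: real and n N m :: nat
  defines "z \<equiv> dft_node N m"
  assumes N: "N > 0" and A: "A \<in> carrier_mat n n" and B: "B \<in> carrier_mat n 1"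
    and C: "C \<in> carrier_mat 1 n"
    and det: "\<And>m. m < N \<Longrightarrow> det (dft_node N m \<cdot>\<^sub>m 1\<^sub>m n - complex_mat A) \<noteq> 0"
    and m: "m < N" and p: "p < N"
  shows "(\<Sum>q<N. complex_mat (lifted_H A C N * mat_inv (1\<^sub>m n - lifted_F A N) * lifted_G A B N
                      + lifted_J A B C D N) $$ (p, q) * z ^ q)
         = z ^ p * transfer_function A B C D z"
proof -
  let ?A = "complex_mat A" and ?B = "complex_mat B" and ?C = "complex_mat C"
  define K where "K = mat_inv (1\<^sub>m n - lifted_F A N)"
  define v where "v = mat N 1 (\<lambda>(q, _). z ^ q)"
  define X where "X = mat_inv (z \<cdot>\<^sub>m 1\<^sub>m n - ?A) * ?B"
  let ?H = "complex_mat (lifted_H A C N)" and ?K = "complex_mat K"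
    and ?G = "complex_mat (lifted_G A B N)" and ?J = "complex_mat (lifted_J A B C D N)"
  let ?L = "lifted_H A C N * K * lifted_G A B N + lifted_J A B C D N"
  have cA: "?A \<in> carrier_mat n n" and cB: "?B \<in> carrier_mat n 1" and cC: "?C \<in> carrier_mat 1 n"
    using A B C by auto
  have cF: "1\<^sub>m n - lifted_F A N \<in> carrier_mat n n"
    unfolding lifted_F_def by (rule minus_carrier_mat[OF pow_carrier_mat[OF A]])
  have cG: "lifted_G A B N \<in> carrier_mat n N" and cH: "lifted_H A C N \<in> carrier_mat N n"
    and cJ: "lifted_J A B C D N \<in> carrier_mat N N"
    using A by (auto simp: lifted_G_def lifted_H_def lifted_J_def)
  have cv: "v \<in> carrier_mat N 1" by (simp add: v_def)
  have zA: "z \<cdot>\<^sub>m 1\<^sub>m n - ?A \<in> carrier_mat n n" using cA by auto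
  note R = mat_inv_properties[OF zA, OF det[OF m, folded z_def]]
  have cX: "X \<in> carrier_mat n 1" using R(1) cB by (simp add: X_def)
  \<comment> \<open>Thus \<open>B\<close> has the shape \<open>(z I - A) X\<close> that the telescoping sum requires.\<close>
  have BX: "(z \<cdot>\<^sub>m 1\<^sub>m n - ?A) * X = ?B"
    using R zA cB by (simp add: X_def flip: assoc_mult_mat[of _ n n _ n _ 1])
  \<comment> \<open>Invertibility is known over the complex numbers and descends to the real matrix \<open>I - F\<close>.\<close>
  have det_cF: "det (complex_mat (1\<^sub>m n - lifted_F A N)) \<noteq> 0"
    using det_one_minus_pow_nonzero[OF cA N det] by (simp add: complex_mat_one_minus_lifted_F[OF A])
  hence "det (1\<^sub>m n - lifted_F A N) \<noteq> 0" by auto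
  note K = mat_inv_properties[OF cF this, folded K_def]
  have KF: "?K * (1\<^sub>m n - ?A ^\<^sub>m N) = 1\<^sub>m n"
    using K(3) complex_mat_mult[OF K(1) cF]
    by (simp add: complex_mat_one_minus_lifted_F[OF A] of_real_hom.mat_hom_one)
  have pow: "?A ^\<^sub>m r \<in> carrier_mat n n" for r using cA by simp

  have zN: "z ^ N = 1" unfolding z_def by (rule dft_node_power_N[OF N])
  have zero_lt_1: "(0::nat) < 1" by simp
  \<comment> \<open>The left factor \<open>I\<close> gives the entries of \<open>G\<close> the form of the telescoping sum with \<open>M = I\<close>.\<close>
  have entry_AB: "complex_of_real ((A ^\<^sub>m r * B) $$ (i, 0))
      = (1\<^sub>m n * ?A ^\<^sub>m r * ?B) $$ (i, 0)" if "i < n" for i r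
  proof -
    have "complex_mat (A ^\<^sub>m r * B) = 1\<^sub>m n * ?A ^\<^sub>m r * ?B"
      using left_mult_one_mat[OF pow[of r]]
      by (simp add: complex_mat_mult[OF pow_carrier_mat[OF A] B] complex_mat_pow[OF A])
    thus ?thesis
      using complex_mat_entry[OF mult_carrier_mat[OF pow_carrier_mat[OF A] B] that zero_lt_1] by simp
  qed
  have entry_CA: "complex_of_real ((C * A ^\<^sub>m r) $$ (0, i)) = (?C * ?A ^\<^sub>m r) $$ (0, i)"
    if "i < n" for i r
  proof -
    have "complex_mat (C * A ^\<^sub>m r) = ?C * ?A ^\<^sub>m r"
      by (simp add: complex_mat_mult[OF C pow_carrier_mat[OF A]] complex_mat_pow[OF A])
    thus ?thesis
      using complex_mat_entry[OF mult_carrier_mat[OF C pow_carrier_mat[OF A]] zero_lt_1 that] by simp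
  qed
  have entry_CAB: "complex_of_real ((C * A ^\<^sub>m r * B) $$ (0, 0))
      = (?C * ?A ^\<^sub>m r * ?B) $$ (0, 0)" for r
  proof -
    have CA: "C * A ^\<^sub>m r \<in> carrier_mat 1 n" using A C by simp
    hence "complex_mat (C * A ^\<^sub>m r * B) = ?C * ?A ^\<^sub>m r * ?B"
      by (simp add: complex_mat_mult[OF _ B] complex_mat_mult[OF C pow_carrier_mat[OF A]] complex_mat_pow[OF A])
    thus ?thesis
      using complex_mat_entry[OF mult_carrier_mat[OF CA B] zero_lt_1 zero_lt_1] by simp
  qed

  have cK: "?K \<in> carrier_mat n n" and cG': "?G \<in> carrier_mat n N" and cH': "?H \<in> carrier_mat N n"
    and cJ': "?J \<in> carrier_mat N N"
    using K(1) cG cH cJ by auto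
  have Gv: "?G * v = (1\<^sub>m n - ?A ^\<^sub>m N) * X"
  proof (rule eq_matI)
    fix i j assume "i < dim_row ((1\<^sub>m n - ?A ^\<^sub>m N) * X)" "j < dim_col ((1\<^sub>m n - ?A ^\<^sub>m N) * X)"
    hence i: "i < n" and j: "j = 0" using pow[of N] cX by auto
    have "(?G * v) $$ (i, 0) = (\<Sum>q<N. z ^ q * (1\<^sub>m n * ?A ^\<^sub>m (N - 1 - q) * ?B) $$ (i, 0))"
      unfolding index_mult_mat_sum[OF cG' cv i zero_lt_1] using i A
      by (intro sum.cong refl)
        (simp add: lifted_G_def v_def entry_AB mult.commute del: index_mult_mat(1))
    also have "\<dots> = (X - ?A ^\<^sub>m N * X) $$ (i, 0)"
      using geometric_input_response[OF cA cX one_carrier_mat i, of 0 z N] cX A i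
      by (simp add: BX zN left_mult_one_mat[OF pow] left_mult_one_mat[OF cX] del: index_mult_mat(1))
    also have "X - ?A ^\<^sub>m N * X = (1\<^sub>m n - ?A ^\<^sub>m N) * X"
      using pow[of N] cX by (simp add: minus_mult_distrib_mat[of _ n n _ _ 1])
    finally show "(?G * v) $$ (i, j) = ((1\<^sub>m n - ?A ^\<^sub>m N) * X) $$ (i, j)" by (simp add: j)
  qed (use cG cv pow[of N] cX in auto)
  have Fc: "1\<^sub>m n - ?A ^\<^sub>m N \<in> carrier_mat n n" by (rule minus_carrier_mat[OF pow])
  have cL: "complex_mat ?L \<in> carrier_mat N N" using cJ by simp
  have "complex_mat ?L = ?H * ?K * ?G + ?J"
  proof -
    have "complex_mat ?L = complex_mat (lifted_H A C N * K * lifted_G A B N) + ?J"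
      using K(1) cG cH cJ by (intro eq_matI) auto
    thus ?thesis
      by (simp only: complex_mat_mult[OF mult_carrier_mat[OF cH K(1)] cG] complex_mat_mult[OF cH K(1)])
  qed
  hence "complex_mat ?L * v = ?H * (?K * (?G * v)) + ?J * v"
    using cK cG' cH' cJ' cv
    by (simp only: add_mult_distrib_mat[OF mult_carrier_mat[OF mult_carrier_mat]]
      assoc_mult_mat[OF mult_carrier_mat[OF cH' cK] cG' cv]
      assoc_mult_mat[OF cH' cK mult_carrier_mat[OF cG' cv]])
  also have "?K * (?G * v) = X"
    unfolding Gv using cK Fc cX KF by (simp flip: assoc_mult_mat[of _ n n _ n _ 1])
  finally have Lv: "complex_mat ?L * v = ?H * X + ?J * v" .

  have HX: "(?H * X) $$ (p, 0) = (?C * ?A ^\<^sub>m p * X) $$ (0, 0)"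
    unfolding index_mult_mat_sum[OF cH' cX p zero_lt_1]
      index_mult_mat_sum[OF mult_carrier_mat[OF cC pow] cX zero_lt_1 zero_lt_1]
    using p A by (intro sum.cong refl) (simp add: lifted_H_def entry_CA del: index_mult_mat(1))
  have Jv: "(?J * v) $$ (p, 0)
      = complex_of_real D * z ^ p + (z ^ p * (?C * X) $$ (0, 0) - (?C * ?A ^\<^sub>m p * X) $$ (0, 0))"
  proof -
    have "(?J * v) $$ (p, 0) = (\<Sum>q<N. ?J $$ (p, q) * z ^ q)"
      unfolding index_mult_mat_sum[OF cJ' cv p zero_lt_1] by (simp add: v_def)
    \<comment> \<open>\<open>J\<close> is lower triangular.\<close>
    also have "\<dots> = (\<Sum>q\<in>{..<Suc p}. ?J $$ (p, q) * z ^ q)"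
      using p by (intro sum.mono_neutral_right) (auto simp: lifted_J_def)
    also have "\<dots> = complex_of_real D * z ^ p
        + (\<Sum>q<p. z ^ q * (?C * ?A ^\<^sub>m (p - 1 - q) * ?B) $$ (0, 0))"
      using p by (auto simp: lifted_J_def entry_CAB mult.commute add.commute intro!: sum.cong
          simp del: index_mult_mat(1))
    finally show ?thesis
      using geometric_input_response[OF cA cX cC, of 0 0 z p] by (simp add: BX)
  qed
  have "(\<Sum>q<N. complex_mat ?L $$ (p, q) * z ^ q) = (complex_mat ?L * v) $$ (p, 0)"
    unfolding index_mult_mat_sum[OF cL cv p zero_lt_1] by (simp add: v_def)
  also have "\<dots> = z ^ p * (complex_of_real D + (?C * X) $$ (0, 0))"
    unfolding Lv using p cH' cX cJ' cv HX Jv by (simp add: algebra_simps)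
  also have "?C * X = ?C * mat_inv (z \<cdot>\<^sub>m 1\<^sub>m n - ?A) * ?B"
    using R(1) cC cB by (simp add: X_def assoc_mult_mat[of _ 1 n _ n _ 1])
  finally show ?thesis using A by (simp add: transfer_function_def K_def)
qed

theorem theorem1:
  fixes A B C :: "real mat" and D :: real and n N :: nat
  assumes "N \<ge> 1"
    and "A \<in> carrier_mat n n"
    and "B \<in> carrier_mat n 1"
    and "C \<in> carrier_mat 1 n"
    and "spectral_radius (complex_mat A) < 1"
  shows "mat_adjoint (dft_mat N)
           * complex_mat (lifted_H A C N * mat_inv (1\<^sub>m n - lifted_F A N) * lifted_G A B N
                            + lifted_J A B C D N)
           * dft_mat N
         = mat_diag N (\<lambda>m. transfer_function A B C D (exp (- \<i> * complex_of_real (dft_freq N m))))"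
proof -
  let ?L = "complex_mat (lifted_H A C N * mat_inv (1\<^sub>m n - lifted_F A N) * lifted_G A B N
                            + lifted_J A B C D N)"
  let ?P = "\<lambda>m. transfer_function A B C D (dft_node N m)"
  have N: "N > 0" using assms(1) by simp
  have cA: "complex_mat A \<in> carrier_mat n n" using assms(2) by simp
  have det: "det (dft_node N m \<cdot>\<^sub>m 1\<^sub>m n - complex_mat A) \<noteq> 0" for m
    by (rule det_resolvent_nonzero[OF cA assms(5)]) simp
  have L: "?L \<in> carrier_mat N N" by (simp add: lifted_J_def)
  have "?L * dft_mat N = dft_mat N * mat_diag N ?P"
  proof (rule eq_matI)
    fix p m assume "p < dim_row (dft_mat N * mat_diag N ?P)" "m < dim_col (dft_mat N * mat_diag N ?P)"
    hence p: "p < N" and m: "m < N" by (auto simp: dft_mat_def mat_diag_def)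
    let ?s = "complex_of_real (sqrt (real N))"
    have "(?L * dft_mat N) $$ (p, m) = (\<Sum>q<N. ?L $$ (p, q) * dft_mat N $$ (q, m))"
      by (rule index_mult_mat_sum[OF L dft_mat_carrier p m])
    also have "\<dots> = (\<Sum>q<N. ?L $$ (p, q) * dft_node N m ^ q) / ?s"
      unfolding sum_divide_distrib using m by (intro sum.cong refl) (simp add: dft_mat_entry)
    also have "\<dots> = dft_node N m ^ p * ?P m / ?s"
      using lifted_system_maps_exponentials[OF N assms(2-4) det m p] by simp
    also have "\<dots> = (dft_mat N * mat_diag N ?P) $$ (p, m)"
      using p m by (simp add: mat_diag_mult_right[OF dft_mat_carrier] dft_mat_entry)
    finally show "(?L * dft_mat N) $$ (p, m) = (dft_mat N * mat_diag N ?P) $$ (p, m)" .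
  qed (simp_all add: dft_mat_def mat_diag_def lifted_J_def)
  hence "mat_adjoint (dft_mat N) * ?L * dft_mat N
      = mat_adjoint (dft_mat N) * dft_mat N * mat_diag N ?P"
    using assoc_mult_mat[OF mat_adjoint_carrier[OF dft_mat_carrier] L dft_mat_carrier]
      assoc_mult_mat[OF mat_adjoint_carrier[OF dft_mat_carrier] dft_mat_carrier mat_diag_dim, of N ?P]
    by simp
  also have "\<dots> = mat_diag N ?P"
    by (simp add: dft_mat_unitary[OF N] left_mult_one_mat[OF mat_diag_dim])
  finally show ?thesis by (simp only: dft_node_def)
qed

end
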